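(* Let Assumptions 1 and 2 of the context hold. Let $q_0\in\mathbb{R}^d$ be the scaled renewable production. Let $\hat z_n$ be any sequence of prices satisfying, for $n$ consumers, $$\hat z_n\in\arg\max_{z\in\mathcal{P}}\{\widehat H_n(z)-z\cdot q_0\},\qquad \widehat H_n(z)=\frac1n\sum_{i=1}^n h(z;\mathbf{R}_i).$$ Then $$\lim_{n\to\infty}\Delta(\hat z_n)=0\quad\text{almost surely},$$ i.e., pricing with $\hat z_n$ is asymptotically optimal. Here $\Delta$ is the mean-field suboptimality gap defined in the context.
   Context: $d\ge 1$ is the number of time periods; $\mathfrak{C}_d$ is the space of non-empty compact subsets of $\mathbb{R}^d$. For $C\subset\mathbb{R}^d$, $\|C\|=\sup\{\|c\|:c\in C\}$. Consumer $i$ has an indifference set $\mathbf{R}_i\subset\mathbb{R}^d$ of acceptable energy consumption profiles and, facing a price vector $p\in\mathbb{R}^d$, chooses a consumption profile in $\arg\min\{p\cdot q: q\in\mathbf{R}_i\}$. Random sets. Given a probability space $(\Omega,\mathcal{F},P)$, a multifunction $R:\Omega\rightrightarrows\mathfrak{C}_d$ (assigning to each $\omega$ a non-empty compact set $R(\omega)\subset\mathbb{R}^d$) is measurable if $\{\omega: R(\omega)\cap O\ne\emptyset\}$ is measurable for all open $O\subset\mathbb{R}^d$; $\mathbf{R}=R(\omega)$ is then a random set. A selection of $\mathbf{R}$ is a random variable $X\in\mathbb{R}^d$ with $P(X\in\mathbf{R})=1$ and $\mathbb{E}\|X\|<\infty$. The expectation is $\mathbb{E}[\mathbf{R}]=\{\mathbb{E}[X]: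 X \text{ is a selection of }\mathbf{R}\}$. Assumption 1. The consumers' indifference sets $\mathbf{R}_1,\mathbf{R}_2,\ldots$ are independent and identically distributed from a distribution over $\mathfrak{C}_d$: there is a non-atomic probability space $(\Omega,\mathcal{F},P)$ and a measurable multifunction $R:\Omega\rightrightarrows\mathfrak{C}_d$ such that $\mathbf{R}=R(\omega)$. Furthermore $\mathbb{E}[\|\mathbf{R}\|]<\infty$. Assumption 2. The grid cost of producing total energy $Q\in\mathbb{R}^d$ given renewable production $Q_0\in\mathbb{R}^d$ is $\sigma(Q,Q_0)=\rho(Q-Q_0)$, where $\rho:\mathbb{R}^d\to\mathbb{R}$ is convex and positively homogeneous of order one: $\rho(\alpha q)=\alpha\rho(q)$ for all $\alpha\ge0$, $q\in\mathbb{R}^d$. Notation. The scaled renewable production $q_0$ is the almost sure limit of $Q_0/n$ as the number $n$ of consumers grows. $\mathcal{P}=\{z\in\mathbb{R}^d: z\cdot q\le\rho(q)\ \forall q\in\mathbb{R}^d\}$. For non-empty compact $C$, $h(p;C)=\min\{q\cdot p: q\in C\}$. $H(p)=h(p;\mathbb{E}[\mathbf{R}])$, which equals $\mathbb{E}[h(p;\mathbf{R})]$. $\mathsf{R}^{\mathsf{DM}}=\max\{H(z)-z\cdot q_0: z\in\mathcal{P}\}$ is the mean-field (per-consumer) cost of the direct control method, i.e. the almost sure limit of $\frac1n\min\{\sigma(\sum_{i=1}^n q_i,Q_0): q_i\in\mathbf{R}_i \text{ for all } i\}$. Suboptimality gap. For any $z\in\mathcal{P}$ at which $H$ is differentiable,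 the mean-field suboptimality gap between deploying the price $z$ and the direct method is characterized as $$\Delta(z)=z\cdot(\bar q(z)-q_0)-\mathsf{R}^{\mathsf{DM}},$$ where $\bar q(z)$ is the average consumption profile under price $z$; when $H$ is differentiable at $z$, $\bar q(z)$ is the unique solution of $\min_{q\in\mathbb{E}[\mathbf{R}]}z\cdot(q-q_0)$. *)

theory Defs
  imports "HOL-Probability.Probability"
begin

definition nonatomic :: "'w measure \<Rightarrow> bool" where
  "nonatomic M \<longleftrightarrow>
     (\<forall>A\<in>sets M. 0 < emeasure M A \<longrightarrow>
        (\<exists>B\<in>sets M. B \<subseteq> A \<and> 0 < emeasure M B \<and> emeasure M B < emeasure M A))"

definition compacts :: "'a::topological_space set set" where
  "compacts = {K. compact K \<and> K \<noteq> {}}"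

definition measurable_multifunction :: "'w measure \<Rightarrow> ('w \<Rightarrow> 'a::topological_space set) \<Rightarrow> bool" where
  "measurable_multifunction M R \<longleftrightarrow>
     (\<forall>\<omega>\<in>space M. R \<omega> \<in> compacts) \<and>
     (\<forall>U. open U \<longrightarrow> {\<omega> \<in> space M. R \<omega> \<inter> U \<noteq> {}} \<in> sets M)"

text \<open>
  The sigma-algebra on the non-empty compact sets generated by the events that a set hits an open
  set. The measurable multifunctions are exactly the maps measurable with respect to it (see below),
  so independence and equality in law of random sets are meant with respect to it.
\<close>

definition hit_algebra :: "'a::topological_space set measure" where
  "hit_algebra = sigma compacts {{K \<in> compacts. K \<inter> U \<noteq> {}} | U. open U}"

lemma measurable_multifunction_iff:
  "measurable_multifunction M R \<longleftrightarrow> R \<in> M \<rightarrow>\<^sub>M hit_algebra"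
proof
  assume R: "measurable_multifunction M R"
  show "R \<in> M \<rightarrow>\<^sub>M hit_algebra"
    unfolding hit_algebra_def
  proof (rule measurable_measure_of)
    show "{{K \<in> compacts. K \<inter> U \<noteq> {}} | U. open U} \<subseteq> Pow (compacts :: 'b set set)"
      by auto
    show "R \<in> space M \<rightarrow> compacts"
      using R by (auto simp: measurable_multifunction_def)
  next
    fix Y :: "'b set set"
    assume "Y \<in> {{K \<in> compacts. K \<inter> U \<noteq> {}} | U. open U}"
    then obtain U where U: "open U" "Y = {K \<in> compacts. K \<inter> U \<noteq> {}}"
      by auto
    have "R -` Y \<inter> space M = {\<omega> \<in> space M. R \<omega> \<inter> U \<noteq> {}}"
      using R U by (auto simp: measurable_multifunction_def)
    then show "R -` Y \<inter> space M \<in> sets M"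
      using R U by (simp add: measurable_multifunction_def)
  qed
next
  assume R: "R \<in> M \<rightarrow>\<^sub>M hit_algebra"
  have gen: "{{K \<in> compacts. K \<inter> U \<noteq> {}} | U. open U} \<subseteq> Pow (compacts :: 'b set set)"
    by auto
  have range: "R \<omega> \<in> compacts" if "\<omega> \<in> space M" for \<omega>
    using measurable_space[OF R that] by (simp add: hit_algebra_def space_measure_of[OF gen])
  have "{\<omega> \<in> space M. R \<omega> \<inter> U \<noteq> {}} \<in> sets M" if "open U" for U
  proof -
    have "{K \<in> compacts. K \<inter> U \<noteq> {}} \<in> sets (hit_algebra :: 'b set measure)"
      unfolding hit_algebra_def sets_measure_of[OF gen]
      using that by (intro sigma_sets.Basic) auto
    from measurable_sets[OF R this]
    have "R -` {K \<in> compacts. K \<inter> U \<noteq> {}} \<inter> space M \<in> sets M" .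
    moreover have "R -` {K \<in> compacts. K \<inter> U \<noteq> {}} \<inter> space M
        = {\<omega> \<in> space M. R \<omega> \<inter> U \<noteq> {}}"
      using range by auto
    ultimately show ?thesis
      by simp
  qed
  with range show "measurable_multifunction M R"
    by (simp add: measurable_multifunction_def)
qed

definition set_norm :: "'a::real_normed_vector set \<Rightarrow> real" where
  "set_norm C = (SUP c\<in>C. norm c)"

definition selection :: "'w measure \<Rightarrow> ('w \<Rightarrow> (real ^ 'd) set) \<Rightarrow> ('w \<Rightarrow> real ^ 'd) \<Rightarrow> bool" where
  "selection M R X \<longleftrightarrow>
     X \<in> borel_measurable M \<and> (AE \<omega> in M. X \<omega> \<in> R \<omega>) \<and> integrable M (\<lambda>\<omega>. norm (X \<omega>))"

definition set_expectation :: "'w measure \<Rightarrow> ('w \<Rightarrow> (real ^ 'd) set) \<Rightarrow> (real ^ 'd) set" where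
  "set_expectation M R = {integral\<^sup>L M X | X. selection M R X}"

definition min_cost :: "real ^ 'd \<Rightarrow> (real ^ 'd) set \<Rightarrow> real" where
  "min_cost p C = (INF q\<in>C. q \<bullet> p)"

definition mean_min_cost :: "'w measure \<Rightarrow> ('w \<Rightarrow> (real ^ 'd) set) \<Rightarrow> real ^ 'd \<Rightarrow> real" where
  "mean_min_cost M R p = min_cost p (set_expectation M R)"

definition empirical_min_cost :: "(nat \<Rightarrow> (real ^ 'd) set) \<Rightarrow> nat \<Rightarrow> real ^ 'd \<Rightarrow> real" where
  "empirical_min_cost C n p = (1 / real n) * (\<Sum>i<n. min_cost p (C i))"

definition price_set :: "(real ^ 'd \<Rightarrow> real) \<Rightarrow> (real ^ 'd) set" where
  "price_set \<rho> = {z. \<forall>q. z \<bullet> q \<le> \<rho> q}"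

text \<open>
  For convex and positively homogeneous \<open>\<rho>\<close> the set \<open>price_set \<rho>\<close> is non-empty and compact, and
  for an integrably bounded random set \<open>mean_min_cost M R\<close> is finite and continuous; the supremum
  below is then a maximum.
\<close>

definition direct_method_cost ::
    "'w measure \<Rightarrow> ('w \<Rightarrow> (real ^ 'd) set) \<Rightarrow> (real ^ 'd \<Rightarrow> real) \<Rightarrow> real ^ 'd \<Rightarrow> real" where
  "direct_method_cost M R \<rho> q0 = (SUP z\<in>price_set \<rho>. mean_min_cost M R z - z \<bullet> q0)"

text \<open>
  The average consumption profile under price \<open>z\<close> solves \<open>min {z \<bullet> (q - q0) | q \<in> E[R]}\<close>. The
  solution is unique where \<open>mean_min_cost M R\<close> is differentiable; at the remaining prices
  \<open>qbar\<close> may pick any solution.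
\<close>

definition average_consumption ::
    "'w measure \<Rightarrow> ('w \<Rightarrow> (real ^ 'd) set) \<Rightarrow> (real ^ 'd \<Rightarrow> real) \<Rightarrow> real ^ 'd \<Rightarrow>
      (real ^ 'd \<Rightarrow> real ^ 'd) \<Rightarrow> bool" where
  "average_consumption M R \<rho> q0 qbar \<longleftrightarrow>
     (\<forall>z\<in>price_set \<rho>.
        is_arg_min (\<lambda>q. z \<bullet> (q - q0)) (\<lambda>q. q \<in> set_expectation M R) (qbar z))"

definition suboptimality_gap ::
    "'w measure \<Rightarrow> ('w \<Rightarrow> (real ^ 'd) set) \<Rightarrow> (real ^ 'd \<Rightarrow> real) \<Rightarrow> real ^ 'd \<Rightarrow>
      (real ^ 'd \<Rightarrow> real ^ 'd) \<Rightarrow> real ^ 'd \<Rightarrow> real" where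
  "suboptimality_gap M R \<rho> q0 qbar z = z \<bullet> (qbar z - q0) - direct_method_cost M R \<rho> q0"

end

theory Submission
  imports Defs
begin

text \<open>
  Write \<open>H\<close> for \<open>mean_min_cost N R\<close> and \<open>H\<^sub>n\<close> for the empirical mean of \<open>min_cost z (Rs i \<omega>)\<close>.
  A solution of \<open>min {z \<bullet> (q - q0) | q \<in> E[R]}\<close> has value \<open>H z - z \<bullet> q0\<close>, so up to sign the gap at a
  price \<open>z\<close> is the amount by which \<open>z\<close> fails to maximise \<open>H z - z \<bullet> q0\<close> over the price set. A maximiser of
  the perturbed objective \<open>H\<^sub>n z - z \<bullet> q0\<close> misses the true maximum by at most twice the uniform
  distance between \<open>H\<^sub>n\<close> and \<open>H\<close> (\<open>SUP_diff_at_approx_maximizer\<close>), and everything reduces to: almost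
  surely \<open>H\<^sub>n\<close> tends to \<open>H\<close> uniformly on the price set.

  A strong law of large numbers gives almost sure convergence at countably many prices, provided
  that \<open>H z\<close>, defined as a minimum over the selection expectation, equals the expectation of
  \<open>min_cost z R\<close> (\<open>mean_min_cost_eq_expectation\<close>). This exchange of minimum and expectation needs a
  measurable selection that minimises \<open>q \<bullet> z\<close>; it is obtained by breaking ties lexicographically
  along a basis until a single point is left (\<open>ex_measurable_minimizer\<close>). Passing from a countable
  dense set of prices to all of them uses that \<open>min_cost\<close> is Lipschitz in the price with constant
  \<open>set_norm\<close>: the strong law for \<open>set_norm (Rs i \<omega>)\<close> bounds the Lipschitz constants of \<open>H\<^sub>n\<close>
  eventually, and the price set is bounded (\<open>uniform_limit_of_equi_Lipschitz\<close>).

  The strong law itself is proved by Garsia's maximal inequality. If the mean is negative, the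
  inequality shows that with positive probability no partial sum is positive; in particular the
  partial sums are bounded above with positive probability. This is a tail event, so by Kolmogorov's
  zero-one law it is almost sure. Applying this to the variables and to their negatives, shifted
  by constants slightly off the mean, squeezes the averages.
\<close>

section \<open>The strong law of large numbers for integrable variables\<close>

text \<open>
  The maximum of the partial sums over the first \<open>n\<close> terms, \<open>0 \<le> n \<le> N\<close>, the empty sum
  included. Peeling off the first term rather than the last exhibits the maximum for the shifted
  sequence, to which stationarity applies.
\<close>

fun running_max :: "nat \<Rightarrow> (nat \<Rightarrow> real) \<Rightarrow> real" where
  "running_max 0 x = 0"
| "running_max (Suc N) x = max 0 (x 0 + running_max N (\<lambda>i. x (Suc i)))"

lemma running_max_nonneg: "0 \<le> running_max N x"
  by (cases N) auto

lemma running_max_le_Suc: "running_max N x \<le> running_max (Suc N) x"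
proof (induction N arbitrary: x)
  case (Suc N)
  have "running_max N (\<lambda>i. x (Suc i)) \<le> running_max (Suc N) (\<lambda>i. x (Suc i))"
    by (rule Suc.IH)
  then show ?case
    unfolding running_max.simps(2)[of N x] running_max.simps(2)[of "Suc N" x]
    by (intro max.mono add_left_mono order_refl)
qed simp

lemma sum_le_running_max: "(\<Sum>i<n. x i) \<le> running_max n x"
proof (induction n arbitrary: x)
  case (Suc n)
  show ?case
    using Suc.IH[of "\<lambda>i. x (Suc i)"] unfolding sum.lessThan_Suc_shift by auto
qed simp

lemma measurable_shift_sequence:
  "(\<lambda>x i. x (Suc i)) \<in> (\<Pi>\<^sub>M i\<in>UNIV. D) \<rightarrow>\<^sub>M (\<Pi>\<^sub>M (i::nat)\<in>UNIV. D)"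
  by (rule measurable_PiM_single') (auto simp: space_PiM PiE_iff)

lemma borel_measurable_running_max:
  "running_max N \<in> borel_measurable (\<Pi>\<^sub>M i\<in>UNIV. borel)"
proof (induction N)
  case 0
  have "running_max 0 = (\<lambda>_. 0)" by auto
  then show ?case by simp
next
  case (Suc N)
  note [measurable] = measurable_compose[OF measurable_shift_sequence Suc.IH]
  have "running_max (Suc N) = (\<lambda>x. max 0 (x 0 + running_max N (\<lambda>i. x (Suc i))))"
    by (rule ext) simp
  then show ?case by simp
qed

lemma integrable_running_max:
  fixes X :: "nat \<Rightarrow> 'a \<Rightarrow> real"
  assumes "\<And>i. integrable M (X i)"
  shows "integrable M (\<lambda>\<omega>. running_max N (\<lambda>i. X i \<omega>))"
  using assms
proof (induction N arbitrary: X)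
  case (Suc N)
  have "integrable M (\<lambda>\<omega>. running_max N (\<lambda>i. X (Suc i) \<omega>))"
    by (rule Suc.IH) (rule Suc.prems)
  then show ?case
    using Suc.prems[of 0] by simp
qed simp

text \<open>
  Integrability of the first variable suffices because the law \<open>D\<close> is common to all of them.
\<close>

locale iid_sequence = prob_space M for M :: "'a measure" +
  fixes X :: "nat \<Rightarrow> 'a \<Rightarrow> real" and D :: "real measure"
  assumes indep: "indep_vars (\<lambda>_. borel) X UNIV"
    and distr_eq: "\<And>i. distr M borel (X i) = D"
    and integrable_0: "integrable M (X 0)"
begin

lemma measurable_X [measurable]: "X i \<in> borel_measurable M"
  using indep by (auto simp: indep_vars_def)

lemma sets_D: "sets D = sets borel"
  using distr_eq[of 0] by auto

lemma prob_space_D: "prob_space D"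
  using prob_space_distr[of "X 0" borel] distr_eq[of 0] by simp

lemma integrable_X: "integrable M (X i)"
proof -
  have "integrable (distr M borel (X 0)) (\<lambda>x. x)"
    using integrable_0 by (subst integrable_distr_eq) auto
  then have "integrable (distr M borel (X i)) (\<lambda>x. x)"
    by (simp add: distr_eq)
  then show ?thesis
    by (subst (asm) integrable_distr_eq) auto
qed

text \<open>
  The joint law is the infinite product of copies of \<open>D\<close>, which the shift preserves.
\<close>

lemma expectation_running_max_shift:
  "expectation (\<lambda>\<omega>. running_max N (\<lambda>i. X (Suc i) \<omega>)) = expectation (\<lambda>\<omega>. running_max N (\<lambda>i. X i \<omega>))"
proof -
  let ?P = "\<Pi>\<^sub>M (i::nat)\<in>UNIV. D" and ?B = "\<Pi>\<^sub>M (i::nat)\<in>UNIV. (borel :: real measure)"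
  let ?shift = "\<lambda>x i. x (Suc i) :: real"
  have sets_P: "sets ?P = sets ?B"
    by (intro sets_PiM_cong) (auto simp: sets_D)
  have law: "distr M ?B (\<lambda>\<omega> i. X i \<omega>) = ?P"
    using indep_vars_iff_distr_eq_PiM[where I="UNIV :: nat set" and M'="\<lambda>_. borel" and X=X] indep
    by (simp add: distr_eq restrict_UNIV)
  have "distr ?P ?P (\<lambda>x. \<lambda>n\<in>UNIV. x (Suc n)) = ?P"
    by (rule distr_PiM_reindex) (auto simp: prob_space_D)
  then have stationary: "distr ?P ?P ?shift = ?P"
    by (simp add: restrict_UNIV)
  have meas [measurable]: "running_max N \<in> borel_measurable ?P"
    using borel_measurable_running_max[of N] sets_P by (simp cong: measurable_cong_sets)
  have shift [measurable]: "?shift \<in> ?B \<rightarrow>\<^sub>M ?B"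
    by (rule measurable_shift_sequence)
  have joint [measurable]: "(\<lambda>\<omega> i. X i \<omega>) \<in> M \<rightarrow>\<^sub>M ?B"
    by (rule measurable_PiM_single') auto
  have "expectation (\<lambda>\<omega>. running_max N (\<lambda>i. X (Suc i) \<omega>)) = (\<integral>x. running_max N (?shift x) \<partial>?P)"
    using integral_distr[OF joint measurable_compose[OF shift borel_measurable_running_max]]
    by (simp only: law)
  also have "\<dots> = (\<integral>x. running_max N x \<partial>?P)"
    using integral_distr[OF measurable_shift_sequence meas] by (simp only: stationary)
  also have "\<dots> = expectation (\<lambda>\<omega>. running_max N (\<lambda>i. X i \<omega>))"
    using integral_distr[OF joint borel_measurable_running_max] by (simp only: law)
  finally show ?thesis .
qed

lemma measurable_running_max [measurable]:
  "(\<lambda>\<omega>. running_max N (\<lambda>i. X i \<omega>)) \<in> borel_measurable M"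
  by (intro borel_measurable_integrable integrable_running_max integrable_X)

text \<open>
  Garsia's argument. Where the running maximum \<open>m\<close> of length \<open>Suc N\<close> is positive, it equals
  \<open>X 0\<close> plus the running maximum of length \<open>N\<close> of the shifted sequence; elsewhere it vanishes while
  the latter is nonnegative. Hence the integrand dominates the difference of the two maxima, whose
  expectation is nonnegative by stationarity and because running maxima increase with their length.
\<close>

lemma maximal_inequality:
  "0 \<le> expectation (\<lambda>\<omega>. X 0 \<omega> * indicator {\<omega>. 0 < running_max (Suc N) (\<lambda>i. X i \<omega>)} \<omega>)"
proof -
  let ?m = "\<lambda>N \<omega>. running_max N (\<lambda>i. X i \<omega>)" and ?m' = "\<lambda>\<omega>. running_max N (\<lambda>i. X (Suc i) \<omega>)"
  have int: "integrable M (?m n)" "integrable M ?m'" for n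
    by (intro integrable_running_max integrable_X)+
  have "0 \<le> expectation (\<lambda>\<omega>. ?m (Suc N) \<omega> - ?m N \<omega>)"
    by (intro Bochner_Integration.integral_nonneg) (use running_max_le_Suc in \<open>auto simp del: running_max.simps\<close>)
  also have "\<dots> = expectation (?m (Suc N)) - expectation (?m N)"
    by (rule Bochner_Integration.integral_diff[OF int(1) int(1)])
  also have "\<dots> = expectation (\<lambda>\<omega>. ?m (Suc N) \<omega> - ?m' \<omega>)"
    unfolding expectation_running_max_shift[of N, symmetric]
    by (rule Bochner_Integration.integral_diff[OF int, symmetric])
  also have "\<dots> \<le> expectation (\<lambda>\<omega>. X 0 \<omega> * indicator {\<omega>. 0 < ?m (Suc N) \<omega>} \<omega>)"
  proof (rule integral_mono)
    show "integrable M (\<lambda>\<omega>. ?m (Suc N) \<omega> - ?m' \<omega>)"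
      by (intro Bochner_Integration.integrable_diff int)
    have "{\<omega> \<in> space M. 0 < ?m (Suc N) \<omega>} \<in> events"
      by measurable
    from integrable_mult_indicator[OF this integrable_X[of 0]]
    show "integrable M (\<lambda>\<omega>. X 0 \<omega> * indicator {\<omega>. 0 < ?m (Suc N) \<omega>} \<omega>)"
      by (rule Bochner_Integration.integrable_cong[THEN iffD1, rotated 2])
         (auto simp: indicator_def)
    show "?m (Suc N) \<omega> - ?m' \<omega> \<le> X 0 \<omega> * indicator {\<omega>. 0 < ?m (Suc N) \<omega>} \<omega>" for \<omega>
      using running_max_nonneg[of N "\<lambda>i. X (Suc i) \<omega>"] by (auto simp: indicator_def)
  qed
  finally show ?thesis .
qed

text \<open>
  If some partial sum were almost surely positive, the indicators in the maximal inequality would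
  increase to 1, and the mean would be nonnegative.
\<close>

lemma partial_sums_nonpos_not_null:
  assumes "expectation (X 0) < 0"
  shows "\<not> (AE \<omega> in M. \<exists>n. 0 < (\<Sum>i<n. X i \<omega>))"
proof
  assume pos: "AE \<omega> in M. \<exists>n. 0 < (\<Sum>i<n. X i \<omega>)"
  let ?f = "\<lambda>N \<omega>. X 0 \<omega> * indicator {\<omega>. 0 < running_max (Suc N) (\<lambda>i. X i \<omega>)} \<omega>"
  have "(\<lambda>N. expectation (?f N)) \<longlonglongrightarrow> expectation (X 0)"
  proof (rule integral_dominated_convergence)
    have [measurable]: "{\<omega> \<in> space M. 0 < running_max (Suc N) (\<lambda>i. X i \<omega>)} \<in> events" for N
      by measurable
    show "?f N \<in> borel_measurable M" for N
    proof -
      have "(\<lambda>\<omega>. X 0 \<omega> * indicator {\<omega> \<in> space M. 0 < running_max (Suc N) (\<lambda>i. X i \<omega>)} \<omega>)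
          \<in> borel_measurable M"
        by measurable
      then show ?thesis
        by (rule measurable_cong[THEN iffD1, rotated]) (auto simp: indicator_def)
    qed
    show "integrable M (\<lambda>\<omega>. norm (X 0 \<omega>))"
      by (intro integrable_norm integrable_X)
    show "AE \<omega> in M. norm (?f N \<omega>) \<le> norm (X 0 \<omega>)" for N
      by (auto simp: indicator_def)
    show "AE \<omega> in M. (\<lambda>N. ?f N \<omega>) \<longlonglongrightarrow> X 0 \<omega>"
      using pos
    proof eventually_elim
      case (elim \<omega>)
      then obtain n where n: "0 < (\<Sum>i<n. X i \<omega>)" by blast
      have inc: "incseq (\<lambda>N. running_max N (\<lambda>i. X i \<omega>))"
        by (intro incseq_SucI running_max_le_Suc)
      have "\<forall>\<^sub>F N in sequentially. ?f N \<omega> = X 0 \<omega>"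
        using eventually_ge_at_top[of n]
      proof eventually_elim
        case (elim N)
        have "0 < running_max n (\<lambda>i. X i \<omega>)"
          using n sum_le_running_max[where n=n and x="\<lambda>i. X i \<omega>"] by linarith
        also have "\<dots> \<le> running_max (Suc N) (\<lambda>i. X i \<omega>)"
          using incseqD[OF inc, of n "Suc N"] elim by simp
        finally show ?case by (simp del: running_max.simps)
      qed
      then show ?case by (rule tendsto_eventually)
    qed
  qed auto
  then have "0 \<le> expectation (X 0)"
    by (rule LIMSEQ_le_const) (use maximal_inequality in auto)
  with assms show False by simp
qed

text \<open>
  Dropping the first \<open>k\<close> terms changes all later partial sums by one and the same finite amount, so
  boundedness is decided by the variables from index \<open>k\<close> on.
\<close>

lemma bounded_partial_sums_tail_event:
  "{\<omega> \<in> space M. \<exists>B::nat. \<forall>n. (\<Sum>i<n. X i \<omega>) \<le> real B}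
    \<in> tail_events (\<lambda>i. sigma_sets (space M) {X i -` A \<inter> space M | A. A \<in> sets borel})"
  (is "?T \<in> tail_events ?A")
  unfolding tail_events_def
proof (rule INT_I)
  fix k :: nat
  let ?F = "sigma (space M) (\<Union> (?A ` {k..}))"
  have sub: "\<Union> (?A ` {k..}) \<subseteq> Pow (space M)"
    using sigma_sets_into_sp[of "{X i -` A \<inter> space M | A. A \<in> sets borel}" "space M" for i]
    by blast
  have [simp]: "space ?F = space M"
    using sub by (rule space_measure_of)
  have meas: "X i \<in> borel_measurable ?F" if "k \<le> i" for i
  proof (rule measurableI)
    fix A :: "real set" assume "A \<in> sets borel"
    then have "X i -` A \<inter> space M \<in> \<Union> (?A ` {k..})"
      using that by (intro UN_I[of i]) (auto intro: sigma_sets.Basic)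
    then show "X i -` A \<inter> space ?F \<in> sets ?F"
      using sub by (auto simp: sets_measure_of)
  qed auto
  have [measurable]: "X (i + k) \<in> borel_measurable ?F" for i
    by (rule meas) simp
  have "?T = {\<omega> \<in> space ?F. \<exists>B::nat. \<forall>n. (\<Sum>i<n. X (i + k) \<omega>) \<le> real B}"
  proof -
    have split: "\<And>n \<omega>. (\<Sum>i<n + k. X i \<omega>) = (\<Sum>i<k. X i \<omega>) + (\<Sum>i<n. X (i + k) \<omega>)"
      by (induct_tac n) (simp_all add: algebra_simps)
    have "(\<exists>B::nat. \<forall>n. (\<Sum>i<n. X i \<omega>) \<le> real B) \<longleftrightarrow> (\<exists>B::nat. \<forall>n. (\<Sum>i<n. X (i + k) \<omega>) \<le> real B)"
      (is "?l \<longleftrightarrow> ?r") for \<omega>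
    proof
      assume ?l
      then obtain B :: nat where B: "\<And>n. (\<Sum>i<n. X i \<omega>) \<le> real B" by blast
      obtain B' :: nat where B': "real B - (\<Sum>i<k. X i \<omega>) \<le> real B'"
        using real_arch_simple by blast
      have "(\<Sum>i<n. X (i + k) \<omega>) \<le> real B'" for n
        using B[of "n + k"] split[of \<omega> n] B' by linarith
      then show ?r by blast
    next
      assume ?r
      then obtain B :: nat where B: "\<And>n. (\<Sum>i<n. X (i + k) \<omega>) \<le> real B" by blast
      obtain B' :: nat where B': "real B + (\<Sum>i<k. \<bar>X i \<omega>\<bar>) \<le> real B'"
        using real_arch_simple by blast
      have "(\<Sum>i<n. X i \<omega>) \<le> real B'" for n
      proof (cases "n \<le> k")
        case True
        have "(\<Sum>i<n. X i \<omega>) \<le> (\<Sum>i<n. \<bar>X i \<omega>\<bar>)"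
          by (intro sum_mono) simp
        also have "\<dots> \<le> (\<Sum>i<k. \<bar>X i \<omega>\<bar>)"
          using True by (intro sum_mono2) auto
        finally show ?thesis using B' by simp
      next
        case False
        then obtain j where "n = j + k"
          by (metis add.commute le_Suc_ex nat_le_linear)
        moreover have "(\<Sum>i<k. X i \<omega>) \<le> (\<Sum>i<k. \<bar>X i \<omega>\<bar>)"
          by (intro sum_mono) simp
        ultimately show ?thesis
          using split[of \<omega> j] B[of j] B' by simp
      qed
      then show ?l by blast
    qed
    then show ?thesis by simp
  qed
  also have "\<dots> \<in> sets ?F"
    by measurable
  also have "sets ?F = sigma_sets (space M) (\<Union> (?A ` {k..}))"
    using sub by (rule sets_measure_of)
  finally show "?T \<in> sigma_sets (space M) (\<Union> (?A ` {k..}))" .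
qed

lemma AE_bounded_partial_sums:
  assumes "expectation (X 0) < 0"
  shows "AE \<omega> in M. \<exists>B::nat. \<forall>n. (\<Sum>i<n. X i \<omega>) \<le> real B"
proof -
  let ?T = "{\<omega> \<in> space M. \<exists>B::nat. \<forall>n. (\<Sum>i<n. X i \<omega>) \<le> real B}"
  let ?A = "\<lambda>i. sigma_sets (space M) {X i -` A \<inter> space M | A. A \<in> sets borel}"
  have "prob ?T = 0 \<or> prob ?T = 1"
  proof (rule kolmogorov_0_1_law)
    show "sigma_algebra (space M) (?A i)" for i
      by (rule sigma_algebra_sigma_sets) auto
    show "indep_sets ?A UNIV"
      using indep by (simp add: indep_vars_def)
    show "?T \<in> tail_events ?A"
      by (rule bounded_partial_sums_tail_event)
  qed
  moreover have "prob ?T \<noteq> 0"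
  proof
    assume "prob ?T = 0"
    then have "AE \<omega> in M. \<not> (\<exists>B::nat. \<forall>n. (\<Sum>i<n. X i \<omega>) \<le> real B)"
      by (subst (asm) prob_Collect_eq_0) auto
    then have "AE \<omega> in M. \<exists>n. 0 < (\<Sum>i<n. X i \<omega>)"
      by eventually_elim (metis linorder_not_less of_nat_0)
    with partial_sums_nonpos_not_null[OF assms] show False by blast
  qed
  ultimately show ?thesis
    by (subst (asm) prob_Collect_eq_1) auto
qed

end

text \<open>
  Centring at a value strictly between the mean and \<open>c\<close> makes the partial sums bounded above almost
  surely; the bound disappears after division by \<open>n\<close>.
\<close>

lemma (in prob_space) AE_averages_eventually_less:
  fixes X :: "nat \<Rightarrow> 'a \<Rightarrow> real"
  assumes "indep_vars (\<lambda>_. borel) X UNIV" and "\<And>i. distr M borel (X i) = D"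
    and "integrable M (X 0)" and c: "expectation (X 0) < c"
  shows "AE \<omega> in M. \<forall>\<^sub>F n in sequentially. (\<Sum>i<n. X i \<omega>) / real n < c"
proof -
  define c' where "c' = (expectation (X 0) + c) / 2"
  have c': "expectation (X 0) < c'" "c' < c"
    using c by (auto simp: c'_def)
  interpret X: iid_sequence M X D
    by unfold_locales (fact assms)+
  interpret Y: iid_sequence M "\<lambda>i \<omega>. X i \<omega> - c'" "distr D borel (\<lambda>x. x - c')"
  proof unfold_locales
    show "indep_vars (\<lambda>_. borel) (\<lambda>i \<omega>. X i \<omega> - c') UNIV"
      by (rule indep_vars_compose2[OF assms(1)]) auto
    show "distr M borel (\<lambda>\<omega>. X i \<omega> - c') = distr D borel (\<lambda>x. x - c')" for i
      unfolding X.distr_eq[of i, symmetric] by (subst distr_distr) (auto simp: comp_def)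
    show "integrable M (\<lambda>\<omega>. X 0 \<omega> - c')"
      using assms(3) by auto
  qed
  have "expectation (\<lambda>\<omega>. X 0 \<omega> - c') < 0"
    using c' assms(3) by (simp add: prob_space)
  from Y.AE_bounded_partial_sums[OF this] show ?thesis
  proof eventually_elim
    case (elim \<omega>)
    then obtain B :: nat where B: "\<And>n. (\<Sum>i<n. X i \<omega> - c') \<le> real B" by blast
    have "(\<lambda>n. c' + real B / real n) \<longlonglongrightarrow> c' + 0"
      by (intro tendsto_intros lim_const_over_n)
    then have "\<forall>\<^sub>F n in sequentially. c' + real B / real n < c"
      using c' by (intro order_tendstoD(2)) auto
    with eventually_gt_at_top[of 0] show ?case
    proof eventually_elim
      case (elim n)
      have "(\<Sum>i<n. X i \<omega>) \<le> real n * c' + real B"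
        using B[of n] by (simp add: sum_subtractf)
      then have "(\<Sum>i<n. X i \<omega>) / real n \<le> c' + real B / real n"
        using elim by (simp add: field_simps)
      with elim show ?case by linarith
    qed
  qed
qed

theorem (in prob_space) strong_law_of_large_numbers:
  fixes X :: "nat \<Rightarrow> 'a \<Rightarrow> real"
  assumes indep: "indep_vars (\<lambda>_. borel) X UNIV" and distr: "\<And>i. distr M borel (X i) = D"
    and int: "integrable M (X 0)"
  shows "AE \<omega> in M. (\<lambda>n. (\<Sum>i<n. X i \<omega>) / real n) \<longlonglongrightarrow> expectation (X 0)"
proof -
  let ?\<mu> = "expectation (X 0)" and ?S = "\<lambda>\<omega> n. (\<Sum>i<n. X i \<omega>) / real n"
  have [measurable]: "X i \<in> borel_measurable M" for i
    using indep by (auto simp: indep_vars_def)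
  have "AE \<omega> in M. \<forall>k. \<forall>\<^sub>F n in sequentially. ?S \<omega> n < ?\<mu> + 1 / real (Suc k)"
    unfolding AE_all_countable
    by (intro allI AE_averages_eventually_less[OF indep distr int]) simp
  moreover have "AE \<omega> in M. \<forall>k. \<forall>\<^sub>F n in sequentially. - ?S \<omega> n < - ?\<mu> + 1 / real (Suc k)"
    unfolding AE_all_countable
  proof
    fix k
    have "AE \<omega> in M. \<forall>\<^sub>F n in sequentially. (\<Sum>i<n. - X i \<omega>) / real n < - ?\<mu> + 1 / real (Suc k)"
    proof (rule AE_averages_eventually_less)
      show "indep_vars (\<lambda>_. borel) (\<lambda>i \<omega>. - X i \<omega>) UNIV"
        by (rule indep_vars_compose2[OF indep]) auto
      show "distr M borel (\<lambda>\<omega>. - X i \<omega>) = distr D borel uminus" for i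
        unfolding distr[of i, symmetric] by (subst distr_distr) (auto simp: comp_def)
    qed (use int in auto)
    then show "AE \<omega> in M. \<forall>\<^sub>F n in sequentially. - ?S \<omega> n < - ?\<mu> + 1 / real (Suc k)"
      by (simp add: sum_negf)
  qed
  ultimately show ?thesis
  proof eventually_elim
    case (elim \<omega>)
    show ?case
    proof (rule tendstoI)
      fix e :: real assume "0 < e"
      then obtain k where k: "1 / real (Suc k) < e"
        using nat_approx_posE by blast
      from elim(1)[rule_format, of k] elim(2)[rule_format, of k]
      show "\<forall>\<^sub>F n in sequentially. dist (?S \<omega> n) ?\<mu> < e"
        by eventually_elim (use k in \<open>auto simp: dist_real_def\<close>)
    qed
  qed
qed

text \<open>
  The form needed for random sets: averages of a functional \<open>g\<close> of independent random elements \<open>Y i\<close>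
  converge to the expectation computed with any \<open>R\<close>, possibly on another probability space, that
  has the same law.
\<close>

lemma (in prob_space) strong_law_for_functionals:
  fixes Y :: "nat \<Rightarrow> 'a \<Rightarrow> 'b" and g :: "'b \<Rightarrow> real"
  assumes indep: "indep_vars (\<lambda>_. H) Y UNIV"
    and law: "\<And>i. distr M H (Y i) = distr N H R"
    and R: "R \<in> N \<rightarrow>\<^sub>M H" and g: "g \<in> borel_measurable H"
    and int: "integrable N (\<lambda>x. g (R x))"
  shows "AE \<omega> in M. (\<lambda>n. (\<Sum>i<n. g (Y i \<omega>)) / real n) \<longlonglongrightarrow> (\<integral>x. g (R x) \<partial>N)"
proof -
  have Y: "Y i \<in> M \<rightarrow>\<^sub>M H" for i
    using indep by (simp add: indep_vars_def)
  have "integrable (distr M H (Y 0)) g"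
    unfolding law using int integrable_distr_eq[OF R g] by simp
  then have int_Y: "integrable M (\<lambda>\<omega>. g (Y 0 \<omega>))"
    by (rule integrable_distr[OF Y])
  have "expectation (\<lambda>\<omega>. g (Y 0 \<omega>)) = (\<integral>x. g (R x) \<partial>N)"
    using integral_distr[OF Y g, of 0] integral_distr[OF R g] unfolding law by (rule trans[OF sym])
  moreover have "distr M borel (\<lambda>\<omega>. g (Y i \<omega>)) = distr (distr N H R) borel g" for i
    using distr_distr[OF g Y, of i] unfolding law comp_def by (rule sym)
  from strong_law_of_large_numbers[OF indep_vars_compose2[OF indep g] this int_Y]
  have "AE \<omega> in M. (\<lambda>n. (\<Sum>i<n. g (Y i \<omega>)) / real n) \<longlonglongrightarrow> expectation (\<lambda>\<omega>. g (Y 0 \<omega>))" .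
  ultimately show ?thesis by (simp only:)
qed

section \<open>Measurability on the space of compact sets\<close>

lemma space_hit_algebra: "space (hit_algebra :: 'a::topological_space set measure) = compacts"
  unfolding hit_algebra_def by (rule space_measure_of) auto

lemma sets_hit_open:
  assumes "open U"
  shows "{C \<in> compacts. C \<inter> U \<noteq> {}} \<in> sets hit_algebra"
  unfolding hit_algebra_def
  by (subst sets_measure_of) (use assms in \<open>auto intro: sigma_sets.Basic\<close>)

text \<open>
  A compact set meets a closed set \<open>K\<close> iff it meets every open neighbourhood of \<open>K\<close> of radius
  \<open>1 / (m + 1)\<close>, because the distance to \<open>K\<close> attains its minimum on it.
\<close>

lemma sets_hit_closed:
  fixes K :: "'a::metric_space set"
  assumes "closed K"
  shows "{C \<in> compacts. C \<inter> K \<noteq> {}} \<in> sets hit_algebra"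
proof (cases "K = {}")
  case False
  let ?U = "\<lambda>m. {x. infdist x K < 1 / real (Suc m)}"
  have "{C \<in> compacts. C \<inter> K \<noteq> {}} = {C \<in> space hit_algebra. \<forall>m. C \<inter> ?U m \<noteq> {}}"
    unfolding space_hit_algebra
  proof (rule Collect_cong, rule conj_cong[OF refl])
    fix C :: "'a set" assume C: "C \<in> compacts"
    show "C \<inter> K \<noteq> {} \<longleftrightarrow> (\<forall>m. C \<inter> ?U m \<noteq> {})"
    proof
      assume "C \<inter> K \<noteq> {}"
      then show "\<forall>m. C \<inter> ?U m \<noteq> {}"
        by (fastforce simp: infdist_zero)
    next
      assume hit: "\<forall>m. C \<inter> ?U m \<noteq> {}"
      have "continuous_on C (\<lambda>x. infdist x K)"
        by (intro continuous_intros)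
      then obtain x where x: "x \<in> C" "\<And>y. y \<in> C \<Longrightarrow> infdist x K \<le> infdist y K"
        using C continuous_attains_inf[of C "\<lambda>x. infdist x K"] by (auto simp: compacts_def)
      have "infdist x K \<le> 0"
      proof (rule ccontr)
        assume "\<not> infdist x K \<le> 0"
        then obtain m where "1 / real (Suc m) < infdist x K"
          using nat_approx_posE[of "infdist x K"] by auto
        then show False
          using hit[rule_format, of m] x(2) by force
      qed
      then have "x \<in> K"
        using assms False infdist_nonneg[of x K] by (simp add: in_closed_iff_infdist_zero)
      with x show "C \<inter> K \<noteq> {}" by blast
    qed
  qed
  also have "\<dots> \<in> sets hit_algebra"
  proof (rule sets.sets_Collect_countable_All)
    fix m
    have "open (?U m)"
      by (intro open_Collect_less continuous_intros)
    then show "{C \<in> space hit_algebra. C \<inter> ?U m \<noteq> {}} \<in> sets hit_algebra"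
      unfolding space_hit_algebra by (rule sets_hit_open)
  qed
  finally show ?thesis .
qed simp

lemma min_cost_attained:
  assumes "C \<in> compacts"
  obtains q where "q \<in> C" "q \<bullet> p = min_cost p C"
proof -
  have "continuous_on C (\<lambda>q. q \<bullet> p)"
    by (intro continuous_intros)
  then obtain q where q: "q \<in> C" "\<And>y. y \<in> C \<Longrightarrow> q \<bullet> p \<le> y \<bullet> p"
    using assms continuous_attains_inf[of C "\<lambda>q. q \<bullet> p"] by (auto simp: compacts_def)
  have "min_cost p C = q \<bullet> p"
    unfolding min_cost_def by (rule cInf_eq_minimum) (use q in auto)
  with q that show thesis by auto
qed

lemma min_cost_le:
  assumes "C \<in> compacts" "q \<in> C"
  shows "min_cost p C \<le> q \<bullet> p"
proof -
  have "compact ((\<lambda>q. q \<bullet> p) ` C)"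
    using assms by (intro compact_continuous_image continuous_intros) (auto simp: compacts_def)
  then show ?thesis
    unfolding min_cost_def using assms
    by (intro cINF_lower) (auto dest: compact_imp_bounded intro: bounded_imp_bdd_below)
qed

lemma norm_le_set_norm:
  assumes "C \<in> compacts" "q \<in> C"
  shows "norm q \<le> set_norm C"
proof -
  have "compact (norm ` C)"
    using assms by (intro compact_continuous_image continuous_intros) (auto simp: compacts_def)
  then show ?thesis
    unfolding set_norm_def using assms
    by (intro cSUP_upper) (auto dest: compact_imp_bounded intro: bounded_imp_bdd_above)
qed

lemma set_norm_nonneg:
  assumes "C \<in> compacts"
  shows "0 \<le> set_norm C"
proof -
  obtain q where "q \<in> C"
    using assms by (auto simp: compacts_def)
  then show ?thesis
    using norm_le_set_norm[OF assms, of q] norm_ge_zero[of q] by linarith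
qed

lemma min_cost_diff_le:
  assumes "C \<in> compacts"
  shows "min_cost p C - min_cost p' C \<le> set_norm C * norm (p - p')"
proof -
  obtain q where q: "q \<in> C" "q \<bullet> p' = min_cost p' C"
    using min_cost_attained[OF assms] .
  have "min_cost p C - min_cost p' C \<le> q \<bullet> (p - p')"
    using min_cost_le[OF assms q(1), of p] q(2) by (simp add: inner_diff_right)
  also have "\<dots> \<le> norm q * norm (p - p')"
    by (rule norm_cauchy_schwarz)
  also have "\<dots> \<le> set_norm C * norm (p - p')"
    using norm_le_set_norm[OF assms q(1)] by (rule mult_right_mono) simp
  finally show ?thesis .
qed

lemma min_cost_Lipschitz:
  assumes "C \<in> compacts"
  shows "\<bar>min_cost p C - min_cost p' C\<bar> \<le> set_norm C * norm (p - p')"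
  using min_cost_diff_le[OF assms, of p p'] min_cost_diff_le[OF assms, of p' p]
  by (simp add: norm_minus_commute abs_le_iff)

lemma abs_min_cost_le:
  assumes "C \<in> compacts"
  shows "\<bar>min_cost p C\<bar> \<le> set_norm C * norm p"
proof -
  have "min_cost 0 C = 0"
    using min_cost_attained[OF assms, of 0] by fastforce
  then show ?thesis
    using min_cost_Lipschitz[OF assms, of p 0] by simp
qed

text \<open>
  The cost is below \<open>a\<close> exactly on the sets that hit an open half-space.
\<close>

lemma borel_measurable_min_cost: "min_cost p \<in> borel_measurable hit_algebra"
  unfolding borel_measurable_iff_less
proof
  fix a
  have "min_cost p C < a \<longleftrightarrow> C \<inter> {q. q \<bullet> p < a} \<noteq> {}" if C: "C \<in> compacts" for C
  proof -
    obtain q where "q \<in> C" "q \<bullet> p = min_cost p C"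
      using min_cost_attained[OF C] .
    then show ?thesis
      using order_le_less_trans[OF min_cost_le[OF C, of _ p]] by force
  qed
  then have "{C \<in> space hit_algebra. min_cost p C < a} = {C \<in> compacts. C \<inter> {q. q \<bullet> p < a} \<noteq> {}}"
    by (auto simp: space_hit_algebra)
  also have "\<dots> \<in> sets hit_algebra"
    by (intro sets_hit_open open_Collect_less continuous_intros)
  finally show "{C \<in> space hit_algebra. min_cost p C < a} \<in> sets hit_algebra" .
qed

lemma borel_measurable_set_norm:
  "(set_norm :: 'a::real_normed_vector set \<Rightarrow> real) \<in> borel_measurable hit_algebra"
  unfolding borel_measurable_iff_greater
proof
  fix a
  have "{C \<in> space hit_algebra. a < set_norm (C :: 'a set)} = {C \<in> compacts. C \<inter> {q::'a. a < norm q} \<noteq> {}}"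
    unfolding space_hit_algebra
  proof (rule Collect_cong, rule conj_cong[OF refl])
    fix C :: "'a set" assume C: "C \<in> compacts"
    have "(\<exists>q\<in>C. a < norm q) \<Longrightarrow> a < set_norm C"
      using norm_le_set_norm[OF C] by force
    moreover have "\<exists>q\<in>C. a < norm q" if "a < set_norm C"
    proof (rule ccontr)
      assume "\<not> (\<exists>q\<in>C. a < norm q)"
      then have "set_norm C \<le> a"
        unfolding set_norm_def using C by (intro cSUP_least) (auto simp: compacts_def not_less)
      with that show False by simp
    qed
    ultimately show "a < set_norm C \<longleftrightarrow> C \<inter> {q. a < norm q} \<noteq> {}" by blast
  qed
  also have "\<dots> \<in> sets hit_algebra"
    by (intro sets_hit_open open_Collect_less continuous_intros)
  finally show "{C \<in> space hit_algebra. a < set_norm (C :: 'a set)} \<in> sets hit_algebra" .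
qed

section \<open>A measurable cost-minimising selection\<close>

definition min_face :: "real ^ 'd \<Rightarrow> (real ^ 'd) set \<Rightarrow> (real ^ 'd) set" where
  "min_face v C = {q \<in> C. q \<bullet> v = min_cost v C}"

lemma min_face_compacts:
  assumes "C \<in> compacts"
  shows "min_face v C \<in> compacts"
proof -
  have "min_face v C = C \<inter> {q. q \<bullet> v = min_cost v C}"
    by (auto simp: min_face_def)
  moreover have "closed {q. q \<bullet> v = min_cost v C}"
    by (intro closed_Collect_eq continuous_intros)
  moreover have "min_face v C \<noteq> {}"
    using min_cost_attained[OF assms, of v] by (auto simp: min_face_def)
  ultimately show ?thesis
    using assms by (auto simp: compacts_def)
qed

text \<open>
  The sets \<open>C \<inter> K \<inter> {q. q \<bullet> v \<le> a}\<close> shrink as \<open>a\<close> decreases to the minimal cost; by compactness they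
  all are non-empty iff the limit set is. Restricting \<open>a\<close> to the rationals turns the event that the
  face hits \<open>K\<close> into a countable intersection of measurable events.
\<close>

lemma min_face_hits_closed_iff:
  assumes C: "C \<in> compacts" and K: "closed K"
  shows "min_face v C \<inter> K \<noteq> {} \<longleftrightarrow>
    (\<forall>a\<in>\<rat>. min_cost v C < a \<longrightarrow> C \<inter> (K \<inter> {q. q \<bullet> v \<le> a}) \<noteq> {})" (is "?l \<longleftrightarrow> ?r")
proof
  assume ?l
  then show ?r by (fastforce simp: min_face_def)
next
  assume r: ?r
  obtain a where "a \<in> \<rat>" "min_cost v C < a"
    using Rats_dense_in_real[of "min_cost v C" "min_cost v C + 1"] by auto
  with r have ne: "C \<inter> K \<noteq> {}" by blast
  have "compact (C \<inter> K)"
    using C K by (auto simp: compacts_def)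
  moreover have "continuous_on (C \<inter> K) (\<lambda>q. q \<bullet> v)"
    by (intro continuous_intros)
  ultimately obtain q where q: "q \<in> C" "q \<in> K" "\<And>y. y \<in> C \<inter> K \<Longrightarrow> q \<bullet> v \<le> y \<bullet> v"
    using ne continuous_attains_inf[of "C \<inter> K" "\<lambda>q. q \<bullet> v"] by blast
  have "q \<bullet> v \<le> min_cost v C"
  proof (rule ccontr)
    assume "\<not> q \<bullet> v \<le> min_cost v C"
    then obtain a where a: "a \<in> \<rat>" "min_cost v C < a" "a < q \<bullet> v"
      using Rats_dense_in_real[of "min_cost v C" "q \<bullet> v"] by auto
    with r obtain y where "y \<in> C" "y \<in> K" "y \<bullet> v \<le> a" by blast
    with q(3)[of y] a(3) show False by auto
  qed
  with min_cost_le[OF C q(1), of v] q show ?l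
    by (auto simp: min_face_def)
qed

lemma measurable_min_face:
  fixes v :: "real ^ 'd"
  shows "min_face v \<in> hit_algebra \<rightarrow>\<^sub>M hit_algebra"
proof (subst measurable_multifunction_iff[symmetric],
    unfold measurable_multifunction_def space_hit_algebra, intro conjI ballI allI impI)
  show "min_face v C \<in> compacts" if "C \<in> compacts" for C
    using that by (rule min_face_compacts)
next
  fix U :: "(real ^ 'd) set" assume "open U"
  then obtain \<D> where D: "countable \<D>" "\<And>K. K \<in> \<D> \<Longrightarrow> closed K" "\<Union>\<D> = U"
    using open_countable_Union_open_cbox[of U] closed_cbox by metis
  have hit: "{C \<in> space hit_algebra. min_face v C \<inter> K \<noteq> {}} \<in> sets hit_algebra"
    if K: "closed K" for K
  proof -
    have "{C \<in> space hit_algebra. min_face v C \<inter> K \<noteq> {}} =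
        {C \<in> space hit_algebra. \<forall>a\<in>\<rat>. min_cost v C < a \<longrightarrow> C \<inter> (K \<inter> {q. q \<bullet> v \<le> a}) \<noteq> {}}"
      using min_face_hits_closed_iff[OF _ K] by (auto simp: space_hit_algebra)
    also have "\<dots> \<in> sets hit_algebra"
    proof (rule sets.sets_Collect_countable_All'[OF sets.sets_Collect_imp])
      fix a
      have "closed (K \<inter> {q. q \<bullet> v \<le> a})"
        by (intro closed_Int K closed_Collect_le continuous_intros)
      then show "{C \<in> space hit_algebra. C \<inter> (K \<inter> {q. q \<bullet> v \<le> a}) \<noteq> {}} \<in> sets hit_algebra"
        unfolding space_hit_algebra by (rule sets_hit_closed)
      show "{C \<in> space hit_algebra. min_cost v C < a} \<in> sets hit_algebra"
        using borel_measurable_min_cost[of v] unfolding borel_measurable_iff_less by blast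
    qed (rule countable_rat)
    finally show ?thesis .
  qed
  have "{C \<in> compacts. min_face v C \<inter> U \<noteq> {}} =
      {C \<in> space hit_algebra. \<exists>K\<in>\<D>. min_face v C \<inter> K \<noteq> {}}"
    using D(3) by (auto simp: space_hit_algebra)
  also have "\<dots> \<in> sets hit_algebra"
    by (rule sets.sets_Collect_countable_Ex'[OF hit D(1)]) (rule D(2))
  finally show "{C \<in> compacts. min_face v C \<inter> U \<noteq> {}} \<in> sets hit_algebra" .
qed

text \<open>
  The points that minimise the inner products with the listed vectors lexicographically, the head
  of the list being the most significant.
\<close>

fun lex_min_face :: "(real ^ 'd) list \<Rightarrow> (real ^ 'd) set \<Rightarrow> (real ^ 'd) set" where
  "lex_min_face [] C = C"
| "lex_min_face (v # vs) C = lex_min_face vs (min_face v C)"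

lemma measurable_lex_min_face: "lex_min_face vs \<in> hit_algebra \<rightarrow>\<^sub>M hit_algebra"
proof (induction vs)
  case (Cons v vs)
  have "lex_min_face (v # vs) = (\<lambda>C. lex_min_face vs (min_face v C))"
    by (rule ext) simp
  then show ?case
    using measurable_compose[OF measurable_min_face Cons.IH] by simp
next
  case Nil
  have "lex_min_face [] = (\<lambda>C. C)" by (rule ext) simp
  then show ?case by simp
qed

lemma lex_min_face_subset: "lex_min_face vs C \<subseteq> C"
  by (induction vs arbitrary: C) (auto simp: min_face_def)

lemma lex_min_face_inner_eq:
  assumes "v \<in> set vs" "p \<in> lex_min_face vs C" "q \<in> lex_min_face vs C"
  shows "p \<bullet> v = q \<bullet> v"
  using assms
proof (induction vs arbitrary: C)
  case (Cons w vs)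
  then have "p \<in> min_face w C" "q \<in> min_face w C"
    using lex_min_face_subset[of vs "min_face w C"] by auto
  with Cons show ?case
    by (cases "v = w") (auto simp: min_face_def)
qed simp

text \<open>
  Minimising first along \<open>p\<close> and then along every basis vector leaves exactly one point: two points
  of the lexicographic face have equal coordinates. A measurable multifunction whose values are
  singletons is a measurable function.
\<close>

lemma ex_measurable_minimizer:
  fixes p :: "real ^ 'd"
  shows "\<exists>s\<in>borel_measurable hit_algebra. \<forall>C\<in>compacts. s C \<in> C \<and> s C \<bullet> p = min_cost p C"
proof -
  obtain bs :: "(real ^ 'd) list" where bs: "set bs = Basis"
    using finite_list[OF finite_Basis] by blast
  let ?L = "lex_min_face (p # bs)"
  define s where "s C = the_elem (?L C)" for C
  have L: "?L C = {s C}" if "C \<in> compacts" for C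
  proof -
    have "?L C \<in> compacts"
      using measurable_space[OF measurable_lex_min_face[of "p # bs"]] that
      unfolding space_hit_algebra .
    then obtain x where x: "x \<in> ?L C"
      by (auto simp: compacts_def)
    have "y = x" if "y \<in> ?L C" for y
    proof (rule euclidean_eqI)
      fix b :: "real ^ 'd" assume "b \<in> Basis"
      then show "y \<bullet> b = x \<bullet> b"
        by (intro lex_min_face_inner_eq[OF _ that x]) (simp add: bs)
    qed
    with x have "?L C = {x}" by blast
    then show ?thesis by (simp add: s_def)
  qed
  show ?thesis
  proof (intro bexI[of _ s] ballI)
    show "s \<in> borel_measurable hit_algebra"
    proof (rule borel_measurableI)
      fix U :: "(real ^ 'd) set" assume "open U"
      then have "{C \<in> compacts. ?L C \<inter> U \<noteq> {}} \<in> sets hit_algebra"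
        using measurable_lex_min_face[of "p # bs"]
        by (subst (asm) measurable_multifunction_iff[symmetric])
           (simp add: measurable_multifunction_def space_hit_algebra)
      also have "{C \<in> compacts. ?L C \<inter> U \<noteq> {}} = s -` U \<inter> space hit_algebra"
        using L by (auto simp: space_hit_algebra)
      finally show "s -` U \<inter> space hit_algebra \<in> sets hit_algebra" .
    qed
    fix C :: "(real ^ 'd) set" assume C: "C \<in> compacts"
    have "s C \<in> min_face p C"
      using L[OF C] lex_min_face_subset[of bs "min_face p C"] by auto
    then show "s C \<in> C \<and> s C \<bullet> p = min_cost p C"
      by (auto simp: min_face_def)
  qed
qed

section \<open>The mean minimal cost as an expectation\<close>

locale integrably_bounded_random_set = prob_space N for N :: "'w measure" +
  fixes R :: "'w \<Rightarrow> (real ^ 'd) set"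
  assumes R: "measurable_multifunction N R"
    and integrable_set_norm: "integrable N (\<lambda>\<omega>. set_norm (R \<omega>))"
begin

lemma measurable_R: "R \<in> N \<rightarrow>\<^sub>M hit_algebra"
  using R by (simp add: measurable_multifunction_iff)

lemma R_compacts: "\<omega> \<in> space N \<Longrightarrow> R \<omega> \<in> compacts"
  using R by (simp add: measurable_multifunction_def)

lemma integrable_min_cost: "integrable N (\<lambda>\<omega>. min_cost p (R \<omega>))"
proof (rule Bochner_Integration.integrable_bound)
  show "integrable N (\<lambda>\<omega>. set_norm (R \<omega>) * norm p)"
    using integrable_set_norm by simp
  show "(\<lambda>\<omega>. min_cost p (R \<omega>)) \<in> borel_measurable N"
    by (rule measurable_compose[OF measurable_R borel_measurable_min_cost])
  show "AE \<omega> in N. norm (min_cost p (R \<omega>)) \<le> norm (set_norm (R \<omega>) * norm p)"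
  proof (rule AE_I2)
    fix \<omega> assume "\<omega> \<in> space N"
    then have "R \<omega> \<in> compacts" by (rule R_compacts)
    then show "norm (min_cost p (R \<omega>)) \<le> norm (set_norm (R \<omega>) * norm p)"
      using abs_min_cost_le[of "R \<omega>" p] by (simp add: set_norm_nonneg)
  qed
qed

lemma expectation_min_cost_le:
  assumes "q \<in> set_expectation N R"
  shows "expectation (\<lambda>\<omega>. min_cost p (R \<omega>)) \<le> q \<bullet> p"
proof -
  have "\<exists>X. q = expectation X \<and> selection N R X"
    using assms unfolding set_expectation_def by (rule CollectD)
  then obtain X where q: "q = expectation X" and "selection N R X"
    by (elim exE conjE)
  then have X: "X \<in> borel_measurable N" "AE \<omega> in N. X \<omega> \<in> R \<omega>" "integrable N (\<lambda>\<omega>. norm (X \<omega>))"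
    unfolding selection_def by simp_all
  have int: "integrable N X"
    using X(3,1) by (rule integrable_norm_cancel)
  have "expectation (\<lambda>\<omega>. min_cost p (R \<omega>)) \<le> expectation (\<lambda>\<omega>. X \<omega> \<bullet> p)"
  proof (rule integral_mono_AE)
    show "AE \<omega> in N. min_cost p (R \<omega>) \<le> X \<omega> \<bullet> p"
      using X(2) AE_space by eventually_elim (rule min_cost_le[OF R_compacts])
    show "integrable N (\<lambda>\<omega>. X \<omega> \<bullet> p)"
      using int by (rule integrable_inner_left)
  qed (rule integrable_min_cost)
  also have "\<dots> = q \<bullet> p"
    unfolding q by (rule integral_inner_left) (rule int)
  finally show ?thesis .
qed

text \<open>
  Every selection costs at least the pointwise minimum, and the measurable minimiser composed with
  \<open>R\<close> is a selection that attains it.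
\<close>

lemma mean_min_cost_eq_expectation:
  "mean_min_cost N R p = expectation (\<lambda>\<omega>. min_cost p (R \<omega>))"
proof -
  obtain s where s: "s \<in> borel_measurable hit_algebra"
    and s_in: "\<And>C. C \<in> compacts \<Longrightarrow> s C \<in> C"
    and s_min: "\<And>C. C \<in> compacts \<Longrightarrow> s C \<bullet> p = min_cost p C"
    using ex_measurable_minimizer[of p] by blast
  let ?X = "\<lambda>\<omega>. s (R \<omega>)"
  have meas: "?X \<in> borel_measurable N"
    by (rule measurable_compose[OF measurable_R s])
  have int: "integrable N ?X"
  proof (rule Bochner_Integration.integrable_bound[OF integrable_set_norm meas], rule AE_I2)
    fix \<omega> assume "\<omega> \<in> space N"
    then have "R \<omega> \<in> compacts" by (rule R_compacts)
    then show "norm (s (R \<omega>)) \<le> norm (set_norm (R \<omega>))"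
      using norm_le_set_norm[OF _ s_in] by (simp add: set_norm_nonneg)
  qed
  have "selection N R ?X"
    unfolding selection_def
    by (intro conjI meas AE_I2 s_in R_compacts integrable_norm int)
  then have "expectation ?X \<in> set_expectation N R"
    unfolding set_expectation_def by (intro CollectI exI[of _ ?X] conjI refl)
  moreover have "expectation ?X \<bullet> p = expectation (\<lambda>\<omega>. min_cost p (R \<omega>))"
  proof -
    have "expectation ?X \<bullet> p = expectation (\<lambda>\<omega>. s (R \<omega>) \<bullet> p)"
      using int by simp
    also have "\<dots> = expectation (\<lambda>\<omega>. min_cost p (R \<omega>))"
      by (intro Bochner_Integration.integral_cong) (auto simp: s_min R_compacts)
    finally show ?thesis .
  qed
  ultimately show ?thesis
    unfolding mean_min_cost_def min_cost_def[of p "set_expectation N R"]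
    using expectation_min_cost_le[where p=p] by (intro cInf_eq_minimum) force+
qed

lemma mean_min_cost_Lipschitz:
  "\<bar>mean_min_cost N R p - mean_min_cost N R p'\<bar> \<le> expectation (\<lambda>\<omega>. set_norm (R \<omega>)) * norm (p - p')"
proof -
  have "mean_min_cost N R p - mean_min_cost N R p' =
      expectation (\<lambda>\<omega>. min_cost p (R \<omega>) - min_cost p' (R \<omega>))"
    unfolding mean_min_cost_eq_expectation
    by (rule Bochner_Integration.integral_diff[OF integrable_min_cost integrable_min_cost, symmetric])
  also have "\<bar>\<dots>\<bar> \<le> expectation (\<lambda>\<omega>. \<bar>min_cost p (R \<omega>) - min_cost p' (R \<omega>)\<bar>)"
    by (rule integral_abs_bound)
  also have "\<dots> \<le> expectation (\<lambda>\<omega>. set_norm (R \<omega>) * norm (p - p'))"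
    by (intro integral_mono) (auto intro!: integrable_abs integrable_min_cost integrable_set_norm
      min_cost_Lipschitz R_compacts Bochner_Integration.integrable_diff)
  also have "\<dots> = expectation (\<lambda>\<omega>. set_norm (R \<omega>)) * norm (p - p')"
    by simp
  finally show ?thesis .
qed

end

section \<open>Uniform convergence and approximate maximisers\<close>

lemma empirical_min_cost_Lipschitz:
  assumes "\<And>i. C i \<in> compacts"
  shows "\<bar>empirical_min_cost C n p - empirical_min_cost C n p'\<bar>
    \<le> (\<Sum>i<n. set_norm (C i)) / real n * norm (p - p')"
proof -
  have "\<bar>\<Sum>i<n. min_cost p (C i) - min_cost p' (C i)\<bar> \<le> (\<Sum>i<n. set_norm (C i) * norm (p - p'))"
    by (intro order_trans[OF sum_abs] sum_mono min_cost_Lipschitz assms)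
  then have "\<bar>\<Sum>i<n. min_cost p (C i) - min_cost p' (C i)\<bar> / real n
      \<le> (\<Sum>i<n. set_norm (C i)) * norm (p - p') / real n"
    unfolding sum_distrib_right by (rule divide_right_mono) simp
  moreover have "empirical_min_cost C n p - empirical_min_cost C n p' =
      (\<Sum>i<n. min_cost p (C i) - min_cost p' (C i)) / real n"
    by (simp add: empirical_min_cost_def sum_subtractf diff_divide_distrib)
  ultimately show ?thesis
    by simp
qed

text \<open>
  Pointwise convergence on a dense set suffices since finitely many balls of radius \<open>\<delta>\<close> around
  points of \<open>D\<close> cover \<open>S\<close>, and on each of them \<open>f n\<close> and \<open>g\<close> differ
  by less than \<open>e / 3\<close> from their values at the centre.
\<close>

lemma uniform_limit_of_equi_Lipschitz:
  fixes f :: "nat \<Rightarrow> 'a::heine_borel \<Rightarrow> real"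
  assumes S: "bounded S" and D: "\<And>U. open U \<Longrightarrow> U \<noteq> {} \<Longrightarrow> \<exists>z\<in>D. z \<in> U"
    and f: "\<forall>\<^sub>F n in sequentially. \<forall>x y. \<bar>f n x - f n y\<bar> \<le> L * dist x y"
    and g: "\<And>x y. \<bar>g x - g y\<bar> \<le> L * dist x y"
    and lim: "\<And>z. z \<in> D \<Longrightarrow> (\<lambda>n. f n z) \<longlonglongrightarrow> g z"
  shows "uniform_limit S f g sequentially"
proof (rule uniform_limitI)
  fix e :: real assume e: "0 < e"
  \<comment> \<open>Adding 1 keeps the denominator positive even if \<open>L = 0\<close>.\<close>
  define K where "K = \<bar>L\<bar> + 1"
  define \<delta> where "\<delta> = e / 3 / K"
  have K: "0 < K" "\<bar>L\<bar> = K - 1"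
    by (simp_all add: K_def)
  then have "0 < \<delta>" "K * \<delta> = e / 3"
    using e by (simp_all add: \<delta>_def)
  then have \<delta>: "0 < \<delta>" "\<bar>L\<bar> * \<delta> < e / 3"
    unfolding K(2) left_diff_distrib by linarith+
  have compact: "compact (closure S)"
    using S by (simp add: compact_closure)
  have cover: "closure S \<subseteq> (\<Union>z\<in>D. ball z \<delta>)"
  proof
    fix x
    obtain z where "z \<in> D" "z \<in> ball x \<delta>"
      using D[of "ball x \<delta>"] \<delta>(1) by auto
    then show "x \<in> (\<Union>z\<in>D. ball z \<delta>)"
      by (auto simp: dist_commute)
  qed
  obtain D' where D': "D' \<subseteq> D" "finite D'" "closure S \<subseteq> (\<Union>z\<in>D'. ball z \<delta>)"
    by (rule compactE_image[OF compact _ cover]) (rule open_ball)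
  have "\<forall>\<^sub>F n in sequentially. \<forall>z\<in>D'. dist (f n z) (g z) < e / 3"
    using D' e by (intro eventually_ball_finite ballI tendstoD lim) auto
  with f show "\<forall>\<^sub>F n in sequentially. \<forall>x\<in>S. dist (f n x) (g x) < e"
  proof eventually_elim
    case (elim n)
    show ?case
    proof
      fix x assume "x \<in> S"
      then obtain z where z: "z \<in> D'" "dist z x < \<delta>"
        using D'(3) closure_subset[of S] by auto
      have "L * dist x z \<le> \<bar>L\<bar> * \<delta>"
        using z(2) by (intro mult_mono) (auto simp: dist_commute)
      then have "L * dist x z < e / 3" using \<delta>(2) by linarith
      then have "\<bar>f n x - f n z\<bar> < e / 3" "\<bar>g x - g z\<bar> < e / 3"
        using elim(1) g order_le_less_trans by blast+
      moreover have "\<bar>f n z - g z\<bar> < e / 3"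
        using elim(2) z(1) by (simp add: dist_real_def)
      ultimately show "dist (f n x) (g x) < e"
        unfolding dist_real_def by linarith
    qed
  qed
qed

text \<open>
  Testing the defining inequality with \<open>b\<close> and \<open>- b\<close> bounds each coordinate of a price.
\<close>

lemma bounded_price_set:
  fixes \<rho> :: "real ^ 'd \<Rightarrow> real"
  shows "bounded (price_set \<rho>)"
proof (rule boundedI)
  fix z :: "real ^ 'd" assume z: "z \<in> price_set \<rho>"
  have "\<bar>z \<bullet> b\<bar> \<le> max (\<rho> b) (\<rho> (- b))" for b
  proof -
    have "z \<bullet> b \<le> \<rho> b" "z \<bullet> (- b) \<le> \<rho> (- b)"
      using z unfolding price_set_def by blast+
    then show ?thesis
      by (auto simp: abs_le_iff intro: max.coboundedI1 max.coboundedI2)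
  qed
  then have "(\<Sum>b\<in>Basis. \<bar>z \<bullet> b\<bar>) \<le> (\<Sum>b\<in>Basis. max (\<rho> b) (\<rho> (- b)))"
    by (intro sum_mono)
  with norm_le_l1[of z] show "norm z \<le> (\<Sum>b\<in>Basis. max (\<rho> b) (\<rho> (- b)))"
    by linarith
qed

text \<open>
  One error \<open>e\<close> is spent on replacing \<open>G\<close> by \<open>F\<close> at a competitor \<open>z\<close>, the other on returning to
  \<open>G\<close> at the maximiser \<open>x\<close> of \<open>F\<close>. That \<open>G\<close> is bounded above on \<open>S\<close> comes out of the same estimate.
\<close>

lemma SUP_diff_at_approx_maximizer:
  fixes G F :: "'a \<Rightarrow> real"
  assumes x: "is_arg_max F (\<lambda>z. z \<in> S) x" and close: "\<And>z. z \<in> S \<Longrightarrow> \<bar>F z - G z\<bar> \<le> e"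
  shows "\<bar>G x - (SUP z\<in>S. G z)\<bar> \<le> 2 * e"
proof -
  have max: "F z \<le> F x" if "z \<in> S" for z
    using x that by (auto simp: is_arg_max_def not_less)
  have x: "x \<in> S"
    using x by (simp add: is_arg_max_def)
  have le: "G z \<le> G x + 2 * e" if "z \<in> S" for z
    using max[OF that] close[OF that] close[OF x] by linarith
  then have "bdd_above (G ` S)"
    by (intro bdd_aboveI2)
  then have "G x \<le> (SUP z\<in>S. G z)"
    using x by (rule cSUP_upper[rotated])
  moreover have "(SUP z\<in>S. G z) \<le> G x + 2 * e"
    using x le by (intro cSUP_least) auto
  moreover have "0 \<le> e"
    using close[OF x] by linarith
  ultimately show ?thesis by linarith
qed

text \<open>
  The demand \<open>qbar z\<close> minimises \<open>q \<bullet> z\<close> over the selection expectation, so the first term of the gap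
  depends on it only through the value \<open>mean_min_cost N R z\<close>.
\<close>

lemma suboptimality_gap_eq:
  assumes "average_consumption N R \<rho> q0 qbar" "z \<in> price_set \<rho>"
  shows "suboptimality_gap N R \<rho> q0 qbar z =
    (mean_min_cost N R z - z \<bullet> q0) - (SUP z\<in>price_set \<rho>. mean_min_cost N R z - z \<bullet> q0)"
proof -
  have "is_arg_min (\<lambda>q. z \<bullet> (q - q0)) (\<lambda>q. q \<in> set_expectation N R) (qbar z)"
    using assms by (auto simp: average_consumption_def)
  then have "qbar z \<in> set_expectation N R"
    and "\<And>q. q \<in> set_expectation N R \<Longrightarrow> qbar z \<bullet> z \<le> q \<bullet> z"
    by (auto simp: is_arg_min_def inner_diff_right not_less inner_commute)
  then have "mean_min_cost N R z = qbar z \<bullet> z"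
    unfolding mean_min_cost_def min_cost_def by (intro cInf_eq_minimum) auto
  then show ?thesis
    by (simp add: suboptimality_gap_def direct_method_cost_def inner_diff_right inner_commute)
qed

section \<open>Asymptotic optimality of the empirical prices\<close>

theorem theorem8:
  fixes N :: "'w measure"
    and R :: "'w \<Rightarrow> (real ^ 'd) set"
    and M :: "'v measure"
    and Rs :: "nat \<Rightarrow> 'v \<Rightarrow> (real ^ 'd) set"
    and \<sigma> :: "real ^ 'd \<Rightarrow> real ^ 'd \<Rightarrow> real"
    and \<rho> :: "real ^ 'd \<Rightarrow> real"
    and Q0 :: "nat \<Rightarrow> 'v \<Rightarrow> real ^ 'd"
    and q0 :: "real ^ 'd"
    and qbar :: "real ^ 'd \<Rightarrow> real ^ 'd"
    and zhat :: "nat \<Rightarrow> 'v \<Rightarrow> real ^ 'd"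
  assumes "prob_space N" and "nonatomic N"
    and "measurable_multifunction N R"
    and "integrable N (\<lambda>\<omega>. set_norm (R \<omega>))"
    and "prob_space M"
    and "prob_space.indep_vars M (\<lambda>_. hit_algebra) Rs UNIV"
    and "\<And>i. distr M hit_algebra (Rs i) = distr N hit_algebra R"
    and "\<And>Q Q'. \<sigma> Q Q' = \<rho> (Q - Q')"
    and "convex_on UNIV \<rho>"
    and "\<And>\<alpha> q. \<alpha> \<ge> 0 \<Longrightarrow> \<rho> (\<alpha> *\<^sub>R q) = \<alpha> * \<rho> q"
    and "\<And>n. Q0 n \<in> borel_measurable M"
    and "AE \<omega> in M. (\<lambda>n. Q0 n \<omega> /\<^sub>R real n) \<longlonglongrightarrow> q0"
    and "average_consumption N R \<rho> q0 qbar"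
    and "\<And>n \<omega>. n \<ge> 1 \<Longrightarrow> \<omega> \<in> space M \<Longrightarrow>
           is_arg_max (\<lambda>z. empirical_min_cost (\<lambda>i. Rs i \<omega>) n z - z \<bullet> q0)
             (\<lambda>z. z \<in> price_set \<rho>) (zhat n \<omega>)"
  shows "AE \<omega> in M. (\<lambda>n. suboptimality_gap N R \<rho> q0 qbar (zhat n \<omega>)) \<longlonglongrightarrow> 0"
proof -
  interpret N: integrably_bounded_random_set N R
    using assms(1,3,4)
    by (intro integrably_bounded_random_set.intro integrably_bounded_random_set_axioms.intro)
  interpret M: prob_space M by (rule assms(5))
  note indep = assms(6) and law = assms(7) and qbar = assms(13) and zhat = assms(14)
  let ?H = "mean_min_cost N R" and ?L = "N.expectation (\<lambda>\<omega>. set_norm (R \<omega>))"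
  let ?Hn = "\<lambda>\<omega>. empirical_min_cost (\<lambda>i. Rs i \<omega>)"
  have Rs: "Rs i \<in> M \<rightarrow>\<^sub>M hit_algebra" for i
    using indep by (simp add: M.indep_vars_def)
  have compacts: "Rs i \<omega> \<in> compacts" if "\<omega> \<in> space M" for i \<omega>
    using measurable_space[OF Rs that] by (simp add: space_hit_algebra)
  obtain D :: "(real ^ 'd) set" where D: "countable D"
      "\<And>U. open U \<Longrightarrow> U \<noteq> {} \<Longrightarrow> \<exists>z\<in>D. z \<in> U"
    by (rule countable_dense_setE) blast
  have "AE \<omega> in M. \<forall>z\<in>D. (\<lambda>n. ?Hn \<omega> n z) \<longlonglongrightarrow> ?H z"
    unfolding AE_ball_countable[OF D(1)]
  proof
    fix z
    have "AE \<omega> in M. (\<lambda>n. (\<Sum>i<n. min_cost z (Rs i \<omega>)) / real n) \<longlonglongrightarrow> ?H z"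
      unfolding N.mean_min_cost_eq_expectation
      by (rule M.strong_law_for_functionals[OF indep law N.measurable_R
            borel_measurable_min_cost N.integrable_min_cost])
    then show "AE \<omega> in M. (\<lambda>n. ?Hn \<omega> n z) \<longlonglongrightarrow> ?H z"
      by (simp add: empirical_min_cost_def)
  qed
  moreover have "AE \<omega> in M. (\<lambda>n. (\<Sum>i<n. set_norm (Rs i \<omega>)) / real n) \<longlonglongrightarrow> ?L"
    by (rule M.strong_law_for_functionals[OF indep law N.measurable_R
          borel_measurable_set_norm N.integrable_set_norm])
  ultimately show ?thesis
    using AE_space
  proof eventually_elim
    case (elim \<omega>)
    have "uniform_limit (price_set \<rho>) (?Hn \<omega>) ?H sequentially"
    proof (rule uniform_limit_of_equi_Lipschitz[OF bounded_price_set D(2)])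
      \<comment> \<open>The averages of the norms converge to \<open>?L\<close>, so \<open>?L + 1\<close> eventually serves as a Lipschitz
          constant for all empirical costs; the limit \<open>?H\<close> has constant \<open>?L\<close>.\<close>
      have "\<forall>\<^sub>F n in sequentially. (\<Sum>i<n. set_norm (Rs i \<omega>)) / real n < ?L + 1"
        using elim(2) by (rule order_tendstoD(2)) simp
      then show "\<forall>\<^sub>F n in sequentially. \<forall>x y. \<bar>?Hn \<omega> n x - ?Hn \<omega> n y\<bar> \<le> (?L + 1) * dist x y"
      proof eventually_elim
        case (elim n)
        show ?case
        proof (intro allI)
          fix x y
          have "\<bar>?Hn \<omega> n x - ?Hn \<omega> n y\<bar> \<le> (\<Sum>i<n. set_norm (Rs i \<omega>)) / real n * norm (x - y)"
            by (rule empirical_min_cost_Lipschitz) (rule compacts[OF \<open>\<omega> \<in> space M\<close>])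
          also have "\<dots> \<le> (?L + 1) * dist x y"
            unfolding dist_norm using elim by (intro mult_right_mono) auto
          finally show "\<bar>?Hn \<omega> n x - ?Hn \<omega> n y\<bar> \<le> (?L + 1) * dist x y" .
        qed
      qed
      show "\<bar>?H x - ?H y\<bar> \<le> (?L + 1) * dist x y" for x y
        using N.mean_min_cost_Lipschitz[of x y] zero_le_dist[of x y]
        unfolding dist_norm distrib_right by linarith
      show "(\<lambda>n. ?Hn \<omega> n z) \<longlonglongrightarrow> ?H z" if "z \<in> D" for z
        using elim(1) that by (rule bspec)
    qed
    show "(\<lambda>n. suboptimality_gap N R \<rho> q0 qbar (zhat n \<omega>)) \<longlonglongrightarrow> 0"
    proof (rule tendstoI)
      fix e :: real assume "0 < e"
      then have "\<forall>\<^sub>F n in sequentially. \<forall>z\<in>price_set \<rho>. dist (?Hn \<omega> n z) (?H z) < e / 3"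
        using \<open>uniform_limit _ _ _ _\<close> by (intro uniform_limitD) auto
      with eventually_ge_at_top[of 1]
      show "\<forall>\<^sub>F n in sequentially. dist (suboptimality_gap N R \<rho> q0 qbar (zhat n \<omega>)) 0 < e"
      proof eventually_elim
        case (elim n)
        have max: "is_arg_max (\<lambda>z. ?Hn \<omega> n z - z \<bullet> q0) (\<lambda>z. z \<in> price_set \<rho>) (zhat n \<omega>)"
          using elim(1) \<open>\<omega> \<in> space M\<close> by (rule zhat)
        then have "zhat n \<omega> \<in> price_set \<rho>"
          by (simp add: is_arg_max_def)
        note gap = suboptimality_gap_eq[OF qbar this]
        have "\<bar>suboptimality_gap N R \<rho> q0 qbar (zhat n \<omega>)\<bar> \<le> 2 * (e / 3)"
          unfolding gap
        proof (rule SUP_diff_at_approx_maximizer[OF max])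
          fix z assume "z \<in> price_set \<rho>"
          with elim(2) have "dist (?Hn \<omega> n z) (?H z) < e / 3" ..
          then show "\<bar>?Hn \<omega> n z - z \<bullet> q0 - (?H z - z \<bullet> q0)\<bar> \<le> e / 3"
            by (simp add: dist_real_def)
        qed
        with \<open>0 < e\<close> show ?case by simp
      qed
    qed
  qed
qed

end
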